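(* If $\alpha$ is a nested word, then the path-star class $\mathcal R^{\alpha}$ is $KKW$-free.
   Context: $\mathbb N=\{1,2,3,\dots\}$. A word is a finite or infinite sequence of letters; letters are natural numbers, and $\alpha_j$ is the $j$-th letter of $\alpha$. For a word $\alpha$ over an alphabet $\mathcal A$ and $\mathcal S\subseteq\mathcal A$, $\alpha^{\mathcal S}$ denotes the word obtained from $\alpha$ by deleting all letters not in $\mathcal S$ (keeping the order of the remaining letters). Branched words: a word $\alpha$ over an alphabet $\mathcal A\subseteq\mathbb N$ is branched, with base set $\mathcal B$ and branch sets $\mathcal H_1,\mathcal H_2,\dots$, if $\mathcal A$ is partitioned into a finite base set $\mathcal B$ and (finitely or infinitely many) branch sets $\mathcal H_1,\mathcal H_2,\dots$, each finite or infinite and ordered by the order inherited from $\mathbb N$, such that in $\alpha$: a base letter can appear immediately after any other letter; the first (smallest) letter of a branch set can appear only immediately after a base letter (or as the first letter of the word); any other letter of a branch set $\mathcal H_i$ can appear only immediately after the letter preceding it in the order of $\mathcal H_i$. Nested words: let $\alpha$ be an infinite branched word over an infinite alphabet $\mathcal A\subseteq\mathbb N$ with base set $\mathcal B_\alpha$ and branch sets $\mathcal H^{\alpha}_1,\mathcal H^{\alpha}_2,\dots$, in which each letter of $\mathcal A$ appears infinitely many times. For a positive integer $\mathfrak b$, $\alpha$ is $\mathfrak b$-nested if every subset $\mathcal S\subseteq\mathcal A$ can be partitioned into a base set $\mathcal B_{\mathcal S}$ and ordered (possibly empty) branch sets $\mathcal H^{\mathcal S}_1,\mathcal H^{\mathcal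 S}_2,\dots$ such that $|\mathcal B_{\mathcal S}|\le\mathfrak b$, $\alpha^{\mathcal S}$ is a branched word with base set $\mathcal B_{\mathcal S}$ and these branch sets, and $\mathcal H^{\mathcal S}_i\subseteq\mathcal H^{\alpha}_i$ with the same ordering for each $i$. A word is nested if it is $\mathfrak b$-nested for some positive integer $\mathfrak b$. Path-star classes: the infinite graph $R^{\alpha}=(V_P\cup V_S,\;E_P\cup E_S)$ has path-vertices $V_P=\{p_j: j\in\mathbb N\}$, star-vertices $V_S=\{s_i: i\in\mathbb N\}$, path edges $E_P=\{p_jp_{j+1}: j\in\mathbb N\}$ and star edges $E_S=\{p_js_{\alpha_j}: j\in\mathbb N\}$. $\mathcal R^{\alpha}$ is the class of all finite induced subgraphs of $R^{\alpha}$ (up to isomorphism). The $(m\times n)$-wall $W_{m\times n}$ is the graph with vertex set $\{(x,y): 0\le x\le 2n+1,\ 0\le y\le m\}$ (integers $x,y$) and edges $(x,y)(x+1,y)$ whenever both are vertices, and $(x,y)(x,y+1)$ whenever both are vertices and $x+y\equiv 0\pmod 2$. A subdivision of a graph is obtained by inserting new degree-2 vertices on some of its edges. A hereditary graph class (closed under induced subgraphs) is $KKW$-free if there exists $t\in\mathbb N$ such that the class does not contain the complete graph $K_t$, the complete bipartite graph $K_{t,t}$, any subdivision of the $(t\times t)$-wall, or the line graph of any subdivision of the $(t\times t)$-wall. *)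

theory Defs
  imports "Graph_Theory.Graph_Theory" "HOL-Library.Infinite_Set"
begin

section \<open>Words\<close>

text \<open>Positions are counted from 0, so the mathematical \<open>\<alpha>\<^sub>j\<close> (\<open>j \<ge> 1\<close>) is \<open>letter \<alpha> (j - 1)\<close>.\<close>

datatype word = Fin_Word "nat list" | Inf_Word "nat \<Rightarrow> nat"

primrec positions :: "word \<Rightarrow> nat set" where
  "positions (Fin_Word w) = {..<length w}"
| "positions (Inf_Word \<alpha>) = UNIV"

primrec letter :: "word \<Rightarrow> nat \<Rightarrow> nat" where
  "letter (Fin_Word w) k = w ! k"
| "letter (Inf_Word \<alpha>) k = \<alpha> k"

text \<open>\<open>restrict_word \<alpha> S\<close> is \<open>\<alpha>\<^sup>S\<close>.  For an infinite word the result is finite or infinite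
  according to whether finitely or infinitely many positions survive.\<close>

primrec restrict_word :: "word \<Rightarrow> nat set \<Rightarrow> word" where
  "restrict_word (Fin_Word w) S = Fin_Word (filter (\<lambda>a. a \<in> S) w)"
| "restrict_word (Inf_Word \<alpha>) S =
     (let J = {j. \<alpha> j \<in> S} in
      if finite J then Fin_Word (map \<alpha> (sorted_list_of_set J))
      else Inf_Word (\<lambda>k. \<alpha> (enumerate J k)))"


section \<open>Branched and nested words\<close>

text \<open>A family of branch sets is indexed by \<open>nat\<close>; members may be empty, which also covers
  families with finitely many branch sets.\<close>

definition base_branch_partition :: "nat set \<Rightarrow> nat set \<Rightarrow> (nat \<Rightarrow> nat set) \<Rightarrow> bool" where
  "base_branch_partition A B H \<longleftrightarrow>
     A = B \<union> (\<Union>i. H i) \<and> finite B \<and> (\<forall>i. B \<inter> H i = {}) \<and>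
     (\<forall>i j. i \<noteq> j \<longrightarrow> H i \<inter> H j = {})"

text \<open>No condition is imposed on occurrences of base letters: they may follow every letter,
  themselves included, and may start the word.\<close>

definition branched :: "word \<Rightarrow> nat set \<Rightarrow> nat set \<Rightarrow> (nat \<Rightarrow> nat set) \<Rightarrow> bool" where
  "branched w A B H \<longleftrightarrow>
     A \<subseteq> {1..} \<and> letter w ` positions w \<subseteq> A \<and> base_branch_partition A B H \<and>
     (\<forall>i. \<forall>b\<in>H i. \<forall>k\<in>positions w. letter w k = b \<longrightarrow>
        (if b = (LEAST c. c \<in> H i)
         then k = 0 \<or> letter w (k - 1) \<in> B
         else k > 0 \<and> letter w (k - 1) = Max {c \<in> H i. c < b}))"

definition b_nested ::
  "nat \<Rightarrow> (nat \<Rightarrow> nat) \<Rightarrow> nat set \<Rightarrow> nat set \<Rightarrow> (nat \<Rightarrow> nat set) \<Rightarrow> bool" where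
  "b_nested b \<alpha> A B H \<longleftrightarrow>
     infinite A \<and> branched (Inf_Word \<alpha>) A B H \<and> (\<forall>a\<in>A. infinite {j. \<alpha> j = a}) \<and>
     (\<forall>S\<subseteq>A. \<exists>B\<^sub>S H\<^sub>S. card B\<^sub>S \<le> b \<and>
        branched (restrict_word (Inf_Word \<alpha>) S) S B\<^sub>S H\<^sub>S \<and> (\<forall>i. H\<^sub>S i \<subseteq> H i))"

definition nested :: "(nat \<Rightarrow> nat) \<Rightarrow> bool" where
  "nested \<alpha> \<longleftrightarrow> (\<exists>b\<ge>1. \<exists>A B H. b_nested b \<alpha> A B H)"


section \<open>Path-star classes\<close>

text \<open>Undirected simple graphs are symmetric loop-free pair digraphs.\<close>

definition undirected :: "'a set \<Rightarrow> ('a \<times> 'a) set \<Rightarrow> 'a pair_pre_digraph" where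
  "undirected V E = \<lparr>pverts = V, parcs = E \<union> E\<inverse>\<rparr>"

text \<open>\<open>Path_Vertex j\<close> is \<open>p\<^sub>j\<^sub>+\<^sub>1\<close>, in line with the positions of words;
  \<open>Star_Vertex i\<close> is \<open>s\<^sub>i\<close> for \<open>i \<ge> 1\<close>.\<close>

datatype path_star_vertex = Path_Vertex nat | Star_Vertex nat

definition path_star_graph :: "(nat \<Rightarrow> nat) \<Rightarrow> path_star_vertex pair_pre_digraph" where
  "path_star_graph \<alpha> =
     undirected (range Path_Vertex \<union> Star_Vertex ` {1..})
       (range (\<lambda>j. (Path_Vertex j, Path_Vertex (Suc j))) \<union>
        range (\<lambda>j. (Path_Vertex j, Star_Vertex (\<alpha> j))))"

text \<open>Graph classes are considered up to isomorphism.  A class is given by representatives on a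
  fixed vertex type, and every property of classes below is stated up to isomorphism.\<close>

definition path_star_class :: "(nat \<Rightarrow> nat) \<Rightarrow> path_star_vertex pair_pre_digraph set" where
  "path_star_class \<alpha> = {G. finite (pverts G) \<and> induced_subgraph (with_proj G) (with_proj (path_star_graph \<alpha>))}"


section \<open>KKW-free classes\<close>

definition wall :: "nat \<Rightarrow> nat \<Rightarrow> (nat \<times> nat) pair_pre_digraph" where
  "wall m n =
     (let V = {0..2 * n + 1} \<times> {0..m} in
      undirected V
        ({((x, y), (x + 1, y)) | x y. (x, y) \<in> V \<and> (x + 1, y) \<in> V} \<union>
         {((x, y), (x, y + 1)) | x y. (x, y) \<in> V \<and> (x, y + 1) \<in> V \<and> even (x + y)}))"

definition line_graph :: "'a pair_pre_digraph \<Rightarrow> 'a set pair_pre_digraph" where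
  "line_graph G =
     (let E = {{u, v} | u v. (u, v) \<in> parcs G} in
      \<lparr>pverts = E, parcs = {(e, f). e \<in> E \<and> f \<in> E \<and> e \<noteq> f \<and> e \<inter> f \<noteq> {}}\<rparr>)"

definition class_contains :: "'a pair_pre_digraph set \<Rightarrow> 'b pair_pre_digraph \<Rightarrow> bool" where
  "class_contains C G \<longleftrightarrow> (\<exists>G'\<in>C. digraph_iso (with_proj G) (with_proj G'))"

definition hereditary :: "'a pair_pre_digraph set \<Rightarrow> bool" where
  "hereditary C \<longleftrightarrow>
     (\<forall>G\<in>C. \<forall>H :: 'a pair_pre_digraph. induced_subgraph (with_proj H) (with_proj G) \<longrightarrow>
        class_contains C H)"

text \<open>As \<open>nat \<times> nat\<close> is infinite, the graphs \<open>W\<close> with \<open>subdivision_pair (wall t t) W\<close> are, up to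
  isomorphism, all subdivisions of the wall (including the wall itself).\<close>

definition KKW_free :: "'a pair_pre_digraph set \<Rightarrow> bool" where
  "KKW_free C \<longleftrightarrow> hereditary C \<and>
     (\<exists>t\<ge>1.
        \<not> (\<exists>G\<in>C. K\<^bsub>t\<^esub> (with_proj G)) \<and>
        \<not> (\<exists>G\<in>C. K\<^bsub>t,t\<^esub> (with_proj G)) \<and>
        \<not> (\<exists>W. subdivision_pair (wall t t) W \<and> class_contains C W) \<and>
        \<not> (\<exists>W. subdivision_pair (wall t t) W \<and> class_contains C (line_graph W)))"


section \<open>Well-formedness\<close>

text \<open>The library's \<open>subdivision\<close>, \<open>induced_subgraph\<close> and \<open>digraph_iso\<close> are false on ill-formed
  graphs, so the following facts ensure that the notions above are not vacuous.\<close>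

lemma pair_bidirected_digraph_undirected:
  assumes "E \<subseteq> V \<times> V" "irrefl E"
  shows "pair_bidirected_digraph (undirected V E)"
  using assms by unfold_locales (auto simp: undirected_def symmetric_def irrefl_def intro: symI)

lemma pair_graph_wall: "pair_graph (wall m n)"
proof -
  interpret pair_bidirected_digraph "wall m n"
    unfolding wall_def Let_def
    by (rule pair_bidirected_digraph_undirected) (auto simp: irrefl_def)
  have fin: "finite (pverts (wall m n))"
    by (simp add: wall_def undirected_def Let_def)
  have "parcs (wall m n) \<subseteq> pverts (wall m n) \<times> pverts (wall m n)"
    by (auto dest: wellformed')
  with fin have "finite (parcs (wall m n))"
    by (meson finite_SigmaI finite_subset)
  with fin show ?thesis by unfold_locales
qed

lemma pair_bidirected_digraph_path_star_graph:
  assumes "\<And>j. \<alpha> j \<ge> 1"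
  shows "pair_bidirected_digraph (path_star_graph \<alpha>)"
  unfolding path_star_graph_def
  using assms by (intro pair_bidirected_digraph_undirected) (auto simp: irrefl_def)

lemma pair_bidirected_digraph_line_graph: "pair_bidirected_digraph (line_graph G)"
  by unfold_locales (auto simp: line_graph_def Let_def symmetric_def intro!: symI)

lemma nested_letter_ge_1:
  assumes "nested \<alpha>"
  shows "\<alpha> j \<ge> 1"
  using assms unfolding nested_def b_nested_def branched_def by fastforce

end

theory Submission
  imports Defs "HOL-Library.Product_Lexorder"
begin

text \<open>
  Write \<open>R\<close> for the path-star graph of the nested word \<open>\<alpha>\<close>.  A path vertex of \<open>R\<close> has at most three
  neighbours and star vertices are pairwise non-adjacent, so every non-empty finite induced subgraph
  of \<open>R\<close> has a vertex of degree at most 3 (\<open>vertex_of_degree_at_most_3\<close>).  This excludes large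
  complete and complete bipartite graphs.

  A triangle of \<open>R\<close> consists of two consecutive path vertices and a star vertex that both of them
  see, so its letter occurs twice in a row in \<open>\<alpha>\<close>.  Only base letters can do that.  In the line graph
  of a subdivided wall every vertex of degree 3 of the wall gives a triangle, and one line-graph
  vertex lies in at most two of these triangles.  Hence an induced copy of such a line graph yields
  at most twice as many vertices of degree 3 as there are base letters (\<open>line_graph_mesh_bound\<close>).

  Nestedness serves to exclude subdivided walls.  Instead of walls, consider a \<open>mesh\<close>:
  \<open>k\<close> disjoint connected rows and \<open>k\<close> disjoint connected columns such that every row meets
  every column in a vertex of degree at least 3.  Walls contain meshes, and meshes survive
  subdivision and isomorphism.  Let \<open>G\<close> be a finite induced subgraph of \<open>R\<close> with maximum degree at most
  3 that has a mesh, and let \<open>S\<close> be the set of letters whose star vertex lies in \<open>G\<close>.  Nestedness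
  makes \<open>\<alpha>\<^sup>S\<close> branched with at most \<open>b\<close> base letters.  The closed neighbourhoods in \<open>G\<close> of the base
  stars form a set \<open>Z\<close> of at most \<open>4b\<close> vertices.  Away from \<open>Z\<close>, a walk along the path meets the
  letters of \<open>S\<close> in the order of one branch of \<open>\<alpha>\<^sup>S\<close>, never skipping one, so what remains of \<open>G\<close> is
  linearly structured: list the letters of \<open>S\<close> outside the base branch by branch; those whose closed
  neighbourhood meets a given connected set disjoint from \<open>Z\<close> then form an interval
  (\<open>star_nbhd_separates\<close>).  Consider the unions of a row and a column that avoid \<open>Z\<close>.  Any two of them share a vertex of degree at least 3, which belongs to the closed
  neighbourhood of a star, so the corresponding intervals meet pairwise.  By the one-dimensional
  Helly theorem all of them contain a common letter; its closed neighbourhood \<open>N\<close> has at most 4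
  vertices.  If \<open>k > 4b + 4\<close>, then some row and some column avoid \<open>Z \<union> N\<close>, a contradiction
  (\<open>nested_mesh_bound\<close>).
\<close>


section \<open>Path-star graphs and their induced subgraphs\<close>

lemma path_star_graph_arcs [simp]:
  "(Path_Vertex p, Path_Vertex q) \<in> parcs (path_star_graph \<alpha>) \<longleftrightarrow> q = Suc p \<or> p = Suc q"
  "(Path_Vertex p, Star_Vertex a) \<in> parcs (path_star_graph \<alpha>) \<longleftrightarrow> a = \<alpha> p"
  "(Star_Vertex a, Path_Vertex p) \<in> parcs (path_star_graph \<alpha>) \<longleftrightarrow> a = \<alpha> p"
  "(Star_Vertex a, Star_Vertex c) \<notin> parcs (path_star_graph \<alpha>)"
  by (auto simp: path_star_graph_def undirected_def)

lemma path_star_class_finite: "G \<in> path_star_class \<alpha> \<Longrightarrow> finite (pverts G)"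
  by (simp add: path_star_class_def)

lemma path_star_class_arcs_iff:
  assumes "G \<in> path_star_class \<alpha>"
  shows "(u, v) \<in> parcs G \<longleftrightarrow>
    u \<in> pverts G \<and> v \<in> pverts G \<and> (u, v) \<in> parcs (path_star_graph \<alpha>)"
  using assms by (auto simp: path_star_class_def induced_subgraph_def)

lemma neighbours_of_path_vertex:
  assumes "G \<in> path_star_class \<alpha>"
  shows "parcs G `` {Path_Vertex p}
    \<subseteq> {Path_Vertex (p - 1), Path_Vertex (Suc p), Star_Vertex (\<alpha> p)}"
proof
  fix v assume "v \<in> parcs G `` {Path_Vertex p}"
  then show "v \<in> {Path_Vertex (p - 1), Path_Vertex (Suc p), Star_Vertex (\<alpha> p)}"
    using path_star_class_arcs_iff[OF assms] by (cases v) auto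
qed

lemma hereditary_path_star_class: "hereditary (path_star_class \<alpha>)"
  unfolding hereditary_def
proof (intro ballI allI impI)
  fix G H :: "path_star_vertex pair_pre_digraph"
  assume G: "G \<in> path_star_class \<alpha>" and H: "induced_subgraph (with_proj H) (with_proj G)"
  have "induced_subgraph (with_proj H) (with_proj (path_star_graph \<alpha>))"
  proof -
    have "subgraph (with_proj H) (with_proj G)"
      and "subgraph (with_proj G) (with_proj (path_star_graph \<alpha>))"
      using G H by (auto simp: path_star_class_def induced_subgraph_def)
    moreover from this have "subgraph (with_proj H) (with_proj (path_star_graph \<alpha>))"
      by (rule subgraph_trans)
    ultimately show ?thesis
      using G H by (auto simp: path_star_class_def induced_subgraph_def subgraph_def)
  qed
  moreover have "finite (pverts H)"
    using G H
    by (auto simp: path_star_class_def induced_subgraph_def subgraph_def intro: finite_subset)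
  moreover have "digraph_iso (with_proj H) (with_proj H)"
  proof -
    let ?f = "\<lparr>iso_verts = id, iso_arcs = id, iso_head = snd, iso_tail = fst\<rparr>"
    have "pre_digraph.digraph_isomorphism (with_proj H) ?f"
      using H by (simp add: pre_digraph.digraph_isomorphism_def induced_subgraph_def subgraph_def)
    moreover have "with_proj H = app_iso ?f (with_proj H)"
      by (simp add: app_iso_def with_proj_def)
    ultimately show ?thesis by (auto simp: digraph_iso_def)
  qed
  ultimately show "class_contains (path_star_class \<alpha>) H"
    by (auto simp: class_contains_def path_star_class_def)
qed

text \<open>Path vertices have this property, and without path vertices there are no arcs at all.\<close>

lemma vertex_of_degree_at_most_3:
  assumes G: "G \<in> path_star_class \<alpha>" and ne: "pverts G \<noteq> {}"
  shows "\<exists>v\<in>pverts G. card (parcs G `` {v}) \<le> 3"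
proof (cases "\<exists>p. Path_Vertex p \<in> pverts G")
  case True
  then obtain p where p: "Path_Vertex p \<in> pverts G" by blast
  have "card (parcs G `` {Path_Vertex p})
      \<le> card {Path_Vertex (p - 1), Path_Vertex (Suc p), Star_Vertex (\<alpha> p)}"
    by (rule card_mono[OF _ neighbours_of_path_vertex[OF G]]) simp
  also have "\<dots> \<le> 3" by (simp add: card_insert_if)
  finally show ?thesis using p by blast
next
  case False
  obtain v where v: "v \<in> pverts G" using ne by blast
  have "w \<notin> parcs G `` {v}" for w
    using False v path_star_class_arcs_iff[OF G] by (cases v; cases w) auto
  then have "parcs G `` {v} = {}" by blast
  then show ?thesis using v by (intro bexI[of _ v]) auto
qed

lemma no_large_complete_graph:
  assumes "G \<in> path_star_class \<alpha>" "5 \<le> t"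
  shows "\<not> K\<^bsub>t\<^esub> (with_proj G)"
proof
  assume "K\<^bsub>t\<^esub> (with_proj G)"
  then have fin: "finite (pverts G)" and card: "card (pverts G) = t"
    and arcs: "parcs G = {(u, v). (u, v) \<in> pverts G \<times> pverts G \<and> u \<noteq> v}"
    unfolding complete_digraph_pair_def by auto
  have "parcs G `` {v} = pverts G - {v}" if "v \<in> pverts G" for v
    using that arcs by auto
  moreover have "pverts G \<noteq> {}" using card assms(2) by auto
  ultimately show False
    using vertex_of_degree_at_most_3[OF assms(1)] card fin assms(2) by auto
qed

lemma no_large_complete_bipartite_graph:
  assumes "G \<in> path_star_class \<alpha>" "4 \<le> t"
  shows "\<not> K\<^bsub>t,t\<^esub> (with_proj G)"
proof
  assume "K\<^bsub>t,t\<^esub> (with_proj G)"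
  then obtain U V where UV: "pverts G = U \<union> V" "U \<inter> V = {}" "card U = t" "card V = t"
    and arcs: "parcs G = U \<times> V \<union> V \<times> U"
    unfolding complete_bipartite_digraph_pair_def by auto
  have "parcs G `` {v} = V" if "v \<in> U" for v using that arcs UV(2) by auto
  moreover have "parcs G `` {v} = U" if "v \<in> V" for v using that arcs UV(2) by auto
  ultimately have "card (parcs G `` {v}) = t" if "v \<in> pverts G" for v
    using that UV by auto
  moreover have "pverts G \<noteq> {}" using UV assms(2) by auto
  ultimately show False
    using vertex_of_degree_at_most_3[OF assms(1)] assms(2) by auto
qed

text \<open>Isomorphisms of digraphs act on vertices and on arcs separately; between graphs whose arcs are
  pairs of vertices the action on arcs is forced, and a map on vertices remains.\<close>

lemma class_contains_embedding:
  assumes "class_contains C G"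
  obtains f G' where "G' \<in> C" "inj_on f (pverts G)" "pverts G' = f ` pverts G"
    "\<And>u v. u \<in> pverts G \<Longrightarrow> v \<in> pverts G \<Longrightarrow> (f u, f v) \<in> parcs G' \<longleftrightarrow> (u, v) \<in> parcs G"
    "parcs G \<subseteq> pverts G \<times> pverts G"
    "parcs G' \<subseteq> pverts G' \<times> pverts G'"
proof -
  obtain G' h where G': "G' \<in> C" and h: "pre_digraph.digraph_isomorphism (with_proj G) h"
    and eq: "with_proj G' = app_iso h (with_proj G)"
    using assms by (auto simp: class_contains_def digraph_iso_def)
  let ?f = "iso_verts h"
  from h have wf: "parcs G \<subseteq> pverts G \<times> pverts G" and inj: "inj_on ?f (pverts G)"
    and ends: "\<And>a. a \<in> parcs G \<Longrightarrow> ?f (fst a) = iso_tail h (iso_arcs h a)"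
      "\<And>a. a \<in> parcs G \<Longrightarrow> ?f (snd a) = iso_head h (iso_arcs h a)"
    by (auto simp: pre_digraph.digraph_isomorphism_def wf_digraph_def)
  have projs: "iso_tail h = fst" "iso_head h = snd"
    using arg_cong[OF eq, of tail] arg_cong[OF eq, of head] by auto
  have verts: "pverts G' = ?f ` pverts G" using arg_cong[OF eq, of verts] by simp
  have arc: "iso_arcs h a = (?f (fst a), ?f (snd a))" if "a \<in> parcs G" for a
    using ends[OF that] projs by (simp add: prod_eq_iff)
  have arcs: "parcs G' = (\<lambda>a. (?f (fst a), ?f (snd a))) ` parcs G"
    using arg_cong[OF eq, of arcs] arc by simp
  have iff: "(?f u, ?f v) \<in> parcs G' \<longleftrightarrow> (u, v) \<in> parcs G"
    if "u \<in> pverts G" "v \<in> pverts G" for u v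
  proof
    assume "(?f u, ?f v) \<in> parcs G'"
    then obtain x y where xy: "(x, y) \<in> parcs G" "?f u = ?f x" "?f v = ?f y"
      unfolding arcs by auto
    then have "x \<in> pverts G" "y \<in> pverts G" using wf by auto
    then have "u = x" "v = y" using xy that inj by (auto dest: inj_onD)
    then show "(u, v) \<in> parcs G" using xy by simp
  next
    assume "(u, v) \<in> parcs G"
    then show "(?f u, ?f v) \<in> parcs G'" unfolding arcs by force
  qed
  have "parcs G' \<subseteq> pverts G' \<times> pverts G'" using wf unfolding arcs verts by auto
  with G' inj verts iff wf show thesis by (rule that)
qed


section \<open>Connected sets and meshes\<close>

text \<open>For symmetric \<open>E\<close> this is connectedness of the subgraph induced on \<open>Q\<close>.  It is phrased through
  sets closed under adjacency rather than through walks because it is used to propagate a property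
  of vertices over all of \<open>Q\<close>.\<close>

definition connected_in :: "'a rel \<Rightarrow> 'a set \<Rightarrow> bool" where
  "connected_in E Q \<longleftrightarrow> (\<forall>P\<subseteq>Q. E `` P \<inter> Q \<subseteq> P \<longrightarrow> P = {} \<or> P = Q)"

lemma connected_inD:
  assumes "connected_in E Q" "P \<subseteq> Q" "\<And>u v. u \<in> P \<Longrightarrow> v \<in> Q \<Longrightarrow> (u, v) \<in> E \<Longrightarrow> v \<in> P"
  shows "P = {} \<or> P = Q"
  using assms unfolding connected_in_def by blast

lemma connected_inI:
  assumes "\<And>P. P \<subseteq> Q \<Longrightarrow> (\<And>u v. u \<in> P \<Longrightarrow> v \<in> Q \<Longrightarrow> (u, v) \<in> E \<Longrightarrow> v \<in> P) \<Longrightarrow> P \<noteq> {} \<Longrightarrow> Q \<subseteq> P"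
  shows "connected_in E Q"
  unfolding connected_in_def
proof (intro allI impI)
  fix P assume "P \<subseteq> Q" "E `` P \<inter> Q \<subseteq> P"
  then show "P = {} \<or> P = Q" using assms[of P] by blast
qed

lemma connected_in_insert:
  assumes Q: "connected_in E Q" and u: "u \<in> Q" and uv: "(u, v) \<in> E" "(v, u) \<in> E"
  shows "connected_in E (insert v Q)"
proof (rule connected_inI)
  fix P assume P: "P \<subseteq> insert v Q" "P \<noteq> {}"
    and cl: "\<And>x y. x \<in> P \<Longrightarrow> y \<in> insert v Q \<Longrightarrow> (x, y) \<in> E \<Longrightarrow> y \<in> P"
  have "P \<inter> Q = {} \<or> P \<inter> Q = Q"
    by (rule connected_inD[OF Q]) (auto intro: cl)
  moreover have "u \<in> P \<longleftrightarrow> v \<in> P" using cl[of u v] cl[of v u] u uv by blast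
  ultimately show "insert v Q \<subseteq> P" using P u by blast
qed

lemma connected_in_Un:
  assumes Q: "connected_in E Q" and R: "connected_in E R" and ne: "Q \<inter> R \<noteq> {}"
  shows "connected_in E (Q \<union> R)"
proof (rule connected_inI)
  fix P assume P: "P \<subseteq> Q \<union> R" "P \<noteq> {}"
    and cl: "\<And>x y. x \<in> P \<Longrightarrow> y \<in> Q \<union> R \<Longrightarrow> (x, y) \<in> E \<Longrightarrow> y \<in> P"
  have "P \<inter> Q = {} \<or> P \<inter> Q = Q"
    by (rule connected_inD[OF Q]) (auto intro: cl)
  moreover have "P \<inter> R = {} \<or> P \<inter> R = R"
    by (rule connected_inD[OF R]) (auto intro: cl)
  ultimately show "Q \<union> R \<subseteq> P" using P ne by blast
qed

lemma connected_in_image: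
  assumes Q: "connected_in E Q" and arcs: "\<And>u v. u \<in> Q \<Longrightarrow> v \<in> Q \<Longrightarrow> (u, v) \<in> E \<Longrightarrow> (f u, f v) \<in> E'"
  shows "connected_in E' (f ` Q)"
proof (rule connected_inI)
  fix P assume P: "P \<subseteq> f ` Q" "P \<noteq> {}"
    and cl: "\<And>x y. x \<in> P \<Longrightarrow> y \<in> f ` Q \<Longrightarrow> (x, y) \<in> E' \<Longrightarrow> y \<in> P"
  have "{q \<in> Q. f q \<in> P} = {} \<or> {q \<in> Q. f q \<in> P} = Q"
    by (rule connected_inD[OF Q]) (auto intro: cl arcs)
  then show "f ` Q \<subseteq> P" using P by blast
qed

text \<open>A mesh abstracts from a wall what the proof needs.  In contrast to a wall it stays a mesh of
  the same size when the graph is subdivided.\<close>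

definition mesh :: "'a pair_pre_digraph \<Rightarrow> nat \<Rightarrow> (nat \<Rightarrow> 'a set) \<Rightarrow> (nat \<Rightarrow> 'a set) \<Rightarrow> bool" where
  "mesh G k R C \<longleftrightarrow>
     (\<forall>i<k. R i \<subseteq> pverts G \<and> connected_in (parcs G) (R i)) \<and>
     (\<forall>j<k. C j \<subseteq> pverts G \<and> connected_in (parcs G) (C j)) \<and>
     (\<forall>i<k. \<forall>j<k. i \<noteq> j \<longrightarrow> R i \<inter> R j = {} \<and> C i \<inter> C j = {}) \<and>
     (\<forall>i<k. \<forall>j<k. \<exists>v\<in>R i \<inter> C j. 3 \<le> card (parcs G `` {v}))"

definition subcubic :: "'a pair_pre_digraph \<Rightarrow> bool" where
  "subcubic G \<longleftrightarrow> (\<forall>v\<in>pverts G. finite (parcs G `` {v}) \<and> card (parcs G `` {v}) \<le> 3)"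

lemma meshD:
  assumes "mesh G k R C"
  shows mesh_verts: "i < k \<Longrightarrow> R i \<subseteq> pverts G" "i < k \<Longrightarrow> C i \<subseteq> pverts G"
    and mesh_connected: "i < k \<Longrightarrow> connected_in (parcs G) (R i)"
      "i < k \<Longrightarrow> connected_in (parcs G) (C i)"
    and mesh_disjoint: "i < k \<Longrightarrow> j < k \<Longrightarrow> i \<noteq> j \<Longrightarrow> R i \<inter> R j = {}"
      "i < k \<Longrightarrow> j < k \<Longrightarrow> i \<noteq> j \<Longrightarrow> C i \<inter> C j = {}"
    and mesh_crossing: "i < k \<Longrightarrow> j < k \<Longrightarrow> \<exists>v\<in>R i \<inter> C j. 3 \<le> card (parcs G `` {v})"
  using assms by (simp_all add: mesh_def)

section \<open>Subdivisions of walls carry large meshes\<close>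

lemma wall_arcs [simp]:
  "((x, y), (x', y')) \<in> parcs (wall m n) \<longleftrightarrow>
     x \<le> 2 * n + 1 \<and> x' \<le> 2 * n + 1 \<and> y \<le> m \<and> y' \<le> m \<and>
     (y' = y \<and> (x' = Suc x \<or> x = Suc x') \<or>
      x' = x \<and> (y' = Suc y \<and> even (x + y) \<or> y = Suc y' \<and> odd (x + y)))"
  by (auto simp: wall_def Let_def undirected_def)

lemma wall_verts [simp]: "(x, y) \<in> pverts (wall m n) \<longleftrightarrow> x \<le> 2 * n + 1 \<and> y \<le> m"
  by (auto simp: wall_def Let_def undirected_def)

lemma wall_neighbours:
  "parcs (wall m n) `` {(x, y)} \<subseteq>
     {(x - 1, y), (Suc x, y), (x, if even (x + y) then Suc y else y - 1)}"
  by (auto split: if_splits)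

lemma subcubic_wall: "subcubic (wall m n)"
  unfolding subcubic_def
proof
  fix v assume "v \<in> pverts (wall m n)"
  obtain x y where v: "v = (x, y)" by force
  let ?N = "{(x - 1, y), (Suc x, y), (x, if even (x + y) then Suc y else y - 1)}"
  have "card ?N \<le> 3" by (simp add: card_insert_if)
  with card_mono[OF _ wall_neighbours[of m n x y]]
  show "finite (parcs (wall m n) `` {v}) \<and> card (parcs (wall m n) `` {v}) \<le> 3"
    using finite_subset[OF wall_neighbours[of m n x y]] unfolding v by fastforce
qed

lemma wall_interior_degree:
  assumes "0 < x" "x < 2 * n + 1" "0 < y" "y < m"
  shows "card (parcs (wall m n) `` {(x, y)}) = 3"
proof -
  let ?N = "{(x - 1, y), (Suc x, y), (x, if even (x + y) then Suc y else y - 1)}"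
  have "parcs (wall m n) `` {(x, y)} = ?N"
    using wall_neighbours[of m n x y] assms by (auto split: if_splits)
  moreover have "card ?N = 3" using assms by (auto simp: card_insert_if)
  ultimately show ?thesis by simp
qed

lemma connected_in_wall_row:
  assumes "y \<le> m" "N \<le> 2 * n + 1"
  shows "connected_in (parcs (wall m n)) ({..N} \<times> {y})"
  using assms(2)
proof (induction N)
  case 0
  then show ?case by (auto intro!: connected_inI)
next
  case (Suc N)
  have "connected_in (parcs (wall m n)) (insert (Suc N, y) ({..N} \<times> {y}))"
    by (rule connected_in_insert[where u = "(N, y)"]) (use Suc assms in auto)
  moreover have "insert (Suc N, y) ({..N} \<times> {y}) = {..Suc N} \<times> {y}" by auto
  ultimately show ?case by simp
qed

text \<open>The vertical edges of a wall between levels \<open>y\<close> and \<open>y + 1\<close> sit at the abscissae of the same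
  parity as \<open>y\<close>.  A connected column is therefore two vertices wide, and zigzags.\<close>

lemma connected_in_wall_column:
  assumes "j \<le> n" "M \<le> m"
  shows "connected_in (parcs (wall m n)) ({2 * j, Suc (2 * j)} \<times> {..M})"
  using assms(2)
proof (induction M)
  case 0
  have "connected_in (parcs (wall m n)) {(2 * j, 0)}" by (auto intro!: connected_inI)
  then have "connected_in (parcs (wall m n)) (insert (Suc (2 * j), 0) {(2 * j, 0)})"
    by (rule connected_in_insert) (use assms in auto)
  moreover have "insert (Suc (2 * j), 0) {(2 * j, 0)} = {2 * j, Suc (2 * j)} \<times> {..0::nat}" by auto
  ultimately show ?case by simp
next
  case (Suc M)
  let ?E = "parcs (wall m n)" and ?Q = "{2 * j, Suc (2 * j)} \<times> {..M}"
  define x where "x = (if even M then 2 * j else Suc (2 * j))"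
  define x' where "x' = (if even M then Suc (2 * j) else 2 * j)"
  have "connected_in ?E (insert (x, Suc M) ?Q)"
    by (rule connected_in_insert[where u = "(x, M)"]) (use Suc assms in \<open>auto simp: x_def\<close>)
  then have "connected_in ?E (insert (x', Suc M) (insert (x, Suc M) ?Q))"
    by (rule connected_in_insert[where u = "(x, Suc M)"])
       (use Suc assms in \<open>auto simp: x_def x'_def\<close>)
  moreover have "insert (x', Suc M) (insert (x, Suc M) ?Q) = {2 * j, Suc (2 * j)} \<times> {..Suc M}"
    by (auto simp: x_def x'_def)
  ultimately show ?case by simp
qed

text \<open>The outermost rows and columns are left out since the vertices on the boundary of a wall need
  not have degree 3.\<close>

lemma mesh_wall:
  "mesh (wall (Suc k) (Suc k)) k (\<lambda>i. {..2 * Suc k + 1} \<times> {Suc i})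
     (\<lambda>j. {2 * Suc j, Suc (2 * Suc j)} \<times> {..Suc k})"
  (is "mesh ?W k ?R ?C")
proof -
  have "connected_in (parcs ?W) (?R i)" if "i < k" for i
    by (rule connected_in_wall_row) (use that in auto)
  moreover have "connected_in (parcs ?W) (?C j)" if "j < k" for j
    by (rule connected_in_wall_column) (use that in auto)
  moreover have "\<exists>v\<in>?R i \<inter> ?C j. 3 \<le> card (parcs ?W `` {v})" if "i < k" "j < k" for i j
    using that wall_interior_degree[of "2 * Suc j" "Suc k" "Suc i" "Suc k"]
    by (intro bexI[of _ "(2 * Suc j, Suc i)"]) auto
  moreover have "?C i \<inter> ?C j = {}" if "i \<noteq> j" for i j
    using that by (auto; presburger)
  moreover have "?R i \<inter> ?R j = {}" if "i \<noteq> j" for i j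
    using that by auto
  moreover have "?R i \<subseteq> pverts ?W" "?C i \<subseteq> pverts ?W" if "i < k" for i
    using that by auto
  ultimately show ?thesis unfolding mesh_def by meson
qed


lemma connected_in_subdivide:
  assumes Q: "connected_in (parcs G) Q"
  shows "connected_in (parcs (subdivide G (u, v) w)) (if u \<in> Q \<and> v \<in> Q then insert w Q else Q)"
    (is "connected_in ?E ?Q")
proof (rule connected_inI)
  fix P assume P: "P \<subseteq> ?Q" "P \<noteq> {}"
    and cl: "\<And>x y. x \<in> P \<Longrightarrow> y \<in> ?Q \<Longrightarrow> (x, y) \<in> ?E \<Longrightarrow> y \<in> P"
  have w_ends: "w \<in> P \<longleftrightarrow> u \<in> P" "w \<in> P \<longleftrightarrow> v \<in> P" if "u \<in> Q" "v \<in> Q"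
  proof -
    have "(u, w) \<in> ?E" "(w, u) \<in> ?E" "(v, w) \<in> ?E" "(w, v) \<in> ?E" by simp_all
    moreover have "u \<in> ?Q" "v \<in> ?Q" "w \<in> ?Q" using that by simp_all
    ultimately show "w \<in> P \<longleftrightarrow> u \<in> P" "w \<in> P \<longleftrightarrow> v \<in> P" using cl by blast+
  qed
  have "P \<inter> Q = {} \<or> P \<inter> Q = Q"
  proof (rule connected_inD[OF Q])
    fix x y assume xy: "x \<in> P \<inter> Q" "y \<in> Q" "(x, y) \<in> parcs G"
    have "y \<in> P"
    proof (cases "(x, y) = (u, v) \<or> (x, y) = (v, u)")
      case True
      then have "u \<in> Q" "v \<in> Q" using xy by auto
      then show ?thesis using True xy w_ends by blast
    next
      case False
      then have "(x, y) \<in> ?E" using xy by auto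
      then show ?thesis using xy cl by auto
    qed
    then show "y \<in> P \<inter> Q" using xy by blast
  qed auto
  then show "?Q \<subseteq> P" using P w_ends by (auto split: if_splits)
qed

lemma neighbours_subdivide:
  assumes G: "pair_bidirected_digraph G" and uv: "(u, v) \<in> parcs G" and w: "w \<notin> pverts G"
    and x: "x \<in> pverts G" and fin: "finite (parcs G `` {x})"
  shows "finite (parcs (subdivide G (u, v) w) `` {x})"
    and "card (parcs (subdivide G (u, v) w) `` {x}) = card (parcs G `` {x})"
proof -
  interpret pair_bidirected_digraph G by fact
  let ?N = "parcs G `` {x}" and ?N' = "parcs (subdivide G (u, v) w) `` {x}"
  have ne: "u \<noteq> v" "v \<noteq> u" using uv by (auto dest: no_loops')
  have vu: "(v, u) \<in> parcs G" using uv by (rule arcs_symmetric)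
  have xw: "x \<noteq> w" "w \<notin> ?N" using x w by (auto dest: wellformed')
  consider "x = u" | "x = v" | "x \<noteq> u" "x \<noteq> v" by blast
  then have "finite ?N' \<and> card ?N' = card ?N"
  proof cases
    case 1
    then have "?N' = insert w (?N - {v})" using xw ne by auto
    moreover have "v \<in> ?N" using 1 uv by blast
    ultimately show ?thesis using xw fin card_Suc_Diff1[OF fin] by simp
  next
    case 2
    then have "?N' = insert w (?N - {u})" using xw ne by auto
    moreover have "u \<in> ?N" using 2 vu by blast
    ultimately show ?thesis using xw fin card_Suc_Diff1[OF fin] by simp
  next
    case 3
    then have "?N' = ?N" using xw by auto
    then show ?thesis using fin by simp
  qed
  then show "finite ?N'" "card ?N' = card ?N" by auto
qed

text \<open>The new vertex joins every row or column that contains both ends of the subdivided edge.  At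
  most one row and at most one column do, so disjointness persists.\<close>

lemma mesh_subdivide:
  assumes G: "pair_bidirected_digraph G" and e: "e \<in> parcs G" and w: "w \<notin> pverts G"
    and sub: "subcubic G" and mesh: "mesh G k R C"
  shows "subcubic (subdivide G e w) \<and> (\<exists>R C. mesh (subdivide G e w) k R C)"
proof -
  interpret pair_bidirected_digraph G by fact
  obtain u v where uv: "e = (u, v)" by force
  let ?H = "subdivide G (u, v) w"
  have arc: "(u, v) \<in> parcs G" using e uv by simp
  have fin: "finite (parcs G `` {x})" if "x \<in> pverts G" for x
    using sub that by (auto simp: subcubic_def)
  note old = neighbours_subdivide[OF G arc w _ fin]
  have "parcs ?H `` {w} = {u, v}"
    using w by (auto dest: wellformed')
  then have "finite (parcs ?H `` {w}) \<and> card (parcs ?H `` {w}) \<le> 3"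
    by (simp add: card_insert_if)
  then have "subcubic ?H"
    using sub old by (auto simp: subcubic_def)
  define ext where "ext Q = (if u \<in> Q \<and> v \<in> Q then insert w Q else Q)" for Q
  have ext_verts: "ext Q \<subseteq> pverts ?H" if "Q \<subseteq> pverts G" for Q
    using that by (auto simp: ext_def)
  have ext_conn: "connected_in (parcs ?H) (ext Q)"
    if "connected_in (parcs G) Q" for Q
    using connected_in_subdivide[OF that, of u v w] by (simp only: ext_def)
  have ext_disj: "ext Q \<inter> ext Q' = {}" if "Q \<inter> Q' = {}" "Q \<subseteq> pverts G" "Q' \<subseteq> pverts G" for Q Q'
    using that w unfolding ext_def by (simp split: if_split) blast
  have "\<exists>x\<in>ext (R i) \<inter> ext (C j). 3 \<le> card (parcs ?H `` {x})" if ij: "i < k" "j < k" for i j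
  proof -
    obtain x where x: "x \<in> R i" "x \<in> C j" "3 \<le> card (parcs G `` {x})"
      using mesh_crossing[OF mesh ij] by blast
    have "x \<in> pverts G" using x(1) mesh_verts(1)[OF mesh ij(1)] by blast
    then have "card (parcs ?H `` {x}) = card (parcs G `` {x})" by (intro old(2))
    moreover have "x \<in> ext (R i) \<inter> ext (C j)" using x by (simp add: ext_def)
    ultimately show ?thesis using x(3) by (intro bexI[of _ x]) simp_all
  qed
  then have "mesh ?H k (\<lambda>i. ext (R i)) (\<lambda>j. ext (C j))"
    unfolding mesh_def using ext_verts ext_conn ext_disj meshD[OF mesh] by presburger
  then show ?thesis using \<open>subcubic ?H\<close> uv by blast
qed

lemma mesh_in_subdivided_wall:
  assumes "subdivision_pair (wall (Suc k) (Suc k)) W"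
  shows "pair_bidirected_digraph W \<and> subcubic W \<and> (\<exists>R C. mesh W k R C)"
  using assms
proof (induction rule: subdivision_pair_induct)
  case base
  then show ?case using subcubic_wall mesh_wall by blast
next
  case (divide e w H)
  then obtain R C where "pair_bidirected_digraph H" "subcubic H" "mesh H k R C" by blast
  moreover from this(1) have "pair_bidirected_digraph (subdivide H e w)"
    using divide by (intro pair_bidirected_digraph.pair_bidirected_digraph_subdivide)
  ultimately show ?case using mesh_subdivide divide by meson
qed

lemma mesh_image:
  assumes inj: "inj_on f (pverts G)" and verts: "pverts G' = f ` pverts G"
    and arcs: "\<And>u v. u \<in> pverts G \<Longrightarrow> v \<in> pverts G \<Longrightarrow> (f u, f v) \<in> parcs G' \<longleftrightarrow> (u, v) \<in> parcs G"
    and wf: "parcs G \<subseteq> pverts G \<times> pverts G" "parcs G' \<subseteq> pverts G' \<times> pverts G'"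
  shows "subcubic G \<Longrightarrow> subcubic G'"
    and "mesh G k R C \<Longrightarrow> mesh G' k (\<lambda>i. f ` R i) (\<lambda>j. f ` C j)"
proof -
  have nb: "parcs G' `` {f u} = f ` (parcs G `` {u})" if "u \<in> pverts G" for u
  proof (intro equalityI subsetI)
    fix y assume y: "y \<in> parcs G' `` {f u}"
    then obtain v where "v \<in> pverts G" "y = f v" using wf(2) verts by blast
    then show "y \<in> f ` (parcs G `` {u})" using y arcs[OF that] by auto
  next
    fix y assume "y \<in> f ` (parcs G `` {u})"
    then show "y \<in> parcs G' `` {f u}" using wf(1) arcs[OF that] by auto
  qed
  have inj_nb: "inj_on f (parcs G `` {u})" for u
    by (rule inj_on_subset[OF inj]) (use wf(1) in blast)
  have card_nb: "card (parcs G' `` {f u}) = card (parcs G `` {u})" if "u \<in> pverts G" for u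
    using nb[OF that] card_image[OF inj_nb] by simp
  show "subcubic G'" if "subcubic G"
    using that card_nb nb unfolding subcubic_def verts by auto
  assume mesh: "mesh G k R C"
  have conn: "connected_in (parcs G') (f ` Q)" if "connected_in (parcs G) Q" "Q \<subseteq> pverts G" for Q
    by (rule connected_in_image[OF that(1)]) (use that arcs in blast)
  have disj: "f ` Q \<inter> f ` Q' = {}" if "Q \<inter> Q' = {}" "Q \<subseteq> pverts G" "Q' \<subseteq> pverts G" for Q Q'
    using that inj_on_image_Int[OF inj, of Q Q'] by simp
  have "\<exists>y\<in>f ` R i \<inter> f ` C j. 3 \<le> card (parcs G' `` {y})" if ij: "i < k" "j < k" for i j
  proof -
    obtain x where x: "x \<in> R i" "x \<in> C j" "3 \<le> card (parcs G `` {x})"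
      using mesh_crossing[OF mesh ij] by blast
    have "x \<in> pverts G" using x(1) mesh_verts(1)[OF mesh ij(1)] by blast
    then have "3 \<le> card (parcs G' `` {f x})" using card_nb x(3) by simp
    then show ?thesis using x(1,2) by blast
  qed
  moreover have "f ` Q \<subseteq> pverts G'" if "Q \<subseteq> pverts G" for Q using that verts by blast
  ultimately show "mesh G' k (\<lambda>i. f ` R i) (\<lambda>j. f ` C j)"
    unfolding mesh_def using conn disj meshD[OF mesh] by presburger
qed

section \<open>Line graphs of subdivided walls\<close>

text \<open>Inside a branched word, a branch letter not preceded by a base letter continues its branch by
  one step: no letter of the branch lies between the two.\<close>

lemma branched_predecessor:
  assumes br: "branched w A B H" and k: "Suc k \<in> positions w" and notB: "letter w (Suc k) \<notin> B"
  obtains (base) "letter w k \<in> B"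
  | (branch) i where "letter w k \<in> H i" "letter w (Suc k) \<in> H i"
      "letter w k < letter w (Suc k)"
      "\<And>c. c \<in> H i \<Longrightarrow> \<not> (letter w k < c \<and> c < letter w (Suc k))"
proof -
  define b where "b = letter w (Suc k)"
  have "b \<in> A" and part: "base_branch_partition A B H"
    using br k by (auto simp: branched_def b_def)
  then obtain i where i: "b \<in> H i"
    using notB by (auto simp: base_branch_partition_def b_def)
  have "if b = (LEAST c. c \<in> H i)
      then Suc k = 0 \<or> letter w (Suc k - 1) \<in> B
      else Suc k > 0 \<and> letter w (Suc k - 1) = Max {c \<in> H i. c < b}"
    using br i k unfolding branched_def b_def by blast
  then have pred: "if b = (LEAST c. c \<in> H i) then letter w k \<in> B
      else letter w k = Max {c \<in> H i. c < b}"
    by (simp split: if_splits)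
  show thesis
  proof (cases "b = (LEAST c. c \<in> H i)")
    case True
    then show ?thesis using pred base by presburger
  next
    case False
    let ?M = "{c \<in> H i. c < b}"
    have "(LEAST c. c \<in> H i) \<in> ?M"
      using False LeastI[of "\<lambda>c. c \<in> H i", OF i] Least_le[of "\<lambda>c. c \<in> H i", OF i] by simp
    then have "?M \<noteq> {}" by blast
    then have "Max ?M \<in> ?M" by (intro Max_in) simp_all
    moreover have eq: "letter w k = Max ?M" using pred False by simp
    ultimately have "letter w k \<in> H i" "letter w k < b" by simp_all
    moreover have "\<not> (letter w k < c \<and> c < b)" if "c \<in> H i" for c
    proof
      assume "letter w k < c \<and> c < b"
      moreover from this have "c \<le> Max ?M" using that by (intro Max_ge) simp_all
      ultimately show False using eq by linarith
    qed
    ultimately show ?thesis using i branch[of i] unfolding b_def by blast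
  qed
qed

lemma repeated_letter_is_base:
  assumes br: "branched (Inf_Word \<alpha>) A B H" and rep: "\<alpha> (Suc p) = \<alpha> p"
  shows "\<alpha> p \<in> B"
proof (rule ccontr)
  assume notB: "\<alpha> p \<notin> B"
  then have "letter (Inf_Word \<alpha>) (Suc p) \<notin> B" using rep by simp
  moreover have "Suc p \<in> positions (Inf_Word \<alpha>)" by simp
  ultimately show False
    using br notB rep by (elim branched_predecessor[where k = p]) simp_all
qed

lemma triangle_contains_base_star:
  assumes br: "branched (Inf_Word \<alpha>) A B H"
    and tri: "(x, y) \<in> parcs (path_star_graph \<alpha>)" "(y, z) \<in> parcs (path_star_graph \<alpha>)"
      "(x, z) \<in> parcs (path_star_graph \<alpha>)"
    and ne: "x \<noteq> y" "y \<noteq> z" "x \<noteq> z"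
  shows "\<exists>a\<in>B. Star_Vertex a \<in> {x, y, z}"
proof (rule ccontr)
  assume none: "\<not> (\<exists>a\<in>B. Star_Vertex a \<in> {x, y, z})"
  have norep: "\<alpha> p \<notin> B \<Longrightarrow> \<alpha> (Suc p) \<noteq> \<alpha> p" "\<alpha> (Suc p) \<notin> B \<Longrightarrow> \<alpha> p \<noteq> \<alpha> (Suc p)" for p
    using repeated_letter_is_base[OF br, of p] by metis+
  show False using tri ne none norep by (cases x; cases y; cases z) auto
qed

text \<open>One crossing on each row suffices: the rows are disjoint, so these are \<open>k\<close> distinct vertices of
  degree at least 3.  Three edges at such a vertex form a triangle of the line graph, so one of them
  is mapped to a base star.  The set \<open>ends a\<close> consists of the at most two ends of the edge
  mapped to the star of \<open>a\<close>.\<close>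

lemma line_graph_mesh_bound:
  assumes br: "branched (Inf_Word \<alpha>) A B H"
    and W: "pair_bidirected_digraph W" and mesh: "mesh W k R C"
    and cc: "class_contains (path_star_class \<alpha>) (line_graph W)"
  shows "k \<le> 2 * card B"
proof -
  interpret pair_bidirected_digraph W by fact
  have finB: "finite B" using br unfolding branched_def base_branch_partition_def by blast
  obtain f G where G: "G \<in> path_star_class \<alpha>" and inj: "inj_on f (pverts (line_graph W))"
    and arcs: "\<And>u v. u \<in> pverts (line_graph W) \<Longrightarrow> v \<in> pverts (line_graph W) \<Longrightarrow>
      (f u, f v) \<in> parcs G \<longleftrightarrow> (u, v) \<in> parcs (line_graph W)"
    using cc by (rule class_contains_embedding) blast
  have edge: "{u, v} \<in> pverts (line_graph W)" if "(u, v) \<in> parcs W" for u v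
    using that by (auto simp: line_graph_def Let_def)
  have adj: "(f d, f e) \<in> parcs (path_star_graph \<alpha>)"
    if "d \<in> pverts (line_graph W)" "e \<in> pverts (line_graph W)" "d \<noteq> e" "v \<in> d" "v \<in> e" for d e v
  proof -
    have "(d, e) \<in> parcs (line_graph W)" using that by (auto simp: line_graph_def Let_def)
    then show ?thesis using arcs[OF that(1,2)] path_star_class_arcs_iff[OF G] by blast
  qed
  define ends where "ends a = \<Union>{e \<in> pverts (line_graph W). f e = Star_Vertex a}" for a
  have base: "v \<in> (\<Union>a\<in>B. ends a)" if deg: "3 \<le> card (parcs W `` {v})" for v
  proof -
    obtain T where T: "T \<subseteq> parcs W `` {v}" "card T = 3"
      using obtain_subset_with_card_n[OF deg] by blast
    then obtain x y z where xyz: "T = {x, y, z}" "x \<noteq> y" "y \<noteq> z" "x \<noteq> z"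
      by (auto simp: card_3_iff)
    then have vx: "(v, x) \<in> parcs W" "(v, y) \<in> parcs W" "(v, z) \<in> parcs W" using T by auto
    let ?e = "\<lambda>u. {v, u}"
    have ne: "?e x \<noteq> ?e y" "?e y \<noteq> ?e z" "?e x \<noteq> ?e z"
      using xyz by (auto simp: doubleton_eq_iff)
    have fne: "f (?e x) \<noteq> f (?e y)" "f (?e y) \<noteq> f (?e z)" "f (?e x) \<noteq> f (?e z)"
      using ne inj_on_eq_iff[OF inj edge edge] vx by metis+
    have adj_v: "(f (?e a), f (?e b)) \<in> parcs (path_star_graph \<alpha>)"
      if "(v, a) \<in> parcs W" "(v, b) \<in> parcs W" "?e a \<noteq> ?e b" for a b
      by (rule adj[OF edge[OF that(1)] edge[OF that(2)] that(3)]) auto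
    have "\<exists>a\<in>B. Star_Vertex a \<in> {f (?e x), f (?e y), f (?e z)}"
      by (rule triangle_contains_base_star[OF br adj_v adj_v adj_v]) (use vx ne fne in auto)
    then obtain a u where "a \<in> B" "(v, u) \<in> parcs W" "f (?e u) = Star_Vertex a"
      using vx by auto
    then show ?thesis using edge[of v u] by (auto simp: ends_def)
  qed
  have card_ends: "finite (ends a) \<and> card (ends a) \<le> 2" for a
  proof (cases "\<exists>e\<in>pverts (line_graph W). f e = Star_Vertex a")
    case True
    then obtain e where e: "e \<in> pverts (line_graph W)" "f e = Star_Vertex a" by blast
    have "d = e" if "d \<in> pverts (line_graph W)" "f d = Star_Vertex a" for d
      using inj_onD[OF inj, of d e] e that by simp
    then have "{d \<in> pverts (line_graph W). f d = Star_Vertex a} = {e}" using e by blast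
    then have "ends a = e" by (simp add: ends_def)
    moreover have "\<exists>u v. e = {u, v}" using e(1) by (auto simp: line_graph_def Let_def)
    ultimately show ?thesis by (auto simp: card_insert_if)
  next
    case False
    then have "ends a = {}" by (auto simp: ends_def)
    then show ?thesis by simp
  qed
  have "\<forall>i<k. \<exists>v. v \<in> R i \<and> 3 \<le> card (parcs W `` {v})"
    using mesh_crossing[OF mesh] by blast
  then obtain d where d: "\<And>i. i < k \<Longrightarrow> d i \<in> R i" "\<And>i. i < k \<Longrightarrow> 3 \<le> card (parcs W `` {d i})"
    by metis
  have "inj_on d {..<k}"
  proof (rule inj_onI)
    fix i j assume "i \<in> {..<k}" "j \<in> {..<k}" "d i = d j"
    then show "i = j" using d(1) mesh_disjoint(1)[OF mesh] by (metis IntI empty_iff lessThan_iff)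
  qed
  then have "k = card (d ` {..<k})" by (simp add: card_image)
  also have "\<dots> \<le> card (\<Union>a\<in>B. ends a)"
    by (rule card_mono) (use finB card_ends base d(2) in auto)
  also have "\<dots> \<le> (\<Sum>a\<in>B. card (ends a))" by (rule card_UN_le[OF finB])
  also have "\<dots> \<le> (\<Sum>a\<in>B. 2)" by (rule sum_mono) (use card_ends in auto)
  finally show ?thesis by simp
qed

section \<open>Meshes in the path-star graph of a nested word are small\<close>

lemma restrict_word_consecutive:
  assumes inf: "infinite {j. \<alpha> j \<in> S}"
    and q: "q < q'" "\<alpha> q \<in> S" "\<alpha> q' \<in> S" "\<And>r. q < r \<Longrightarrow> r < q' \<Longrightarrow> \<alpha> r \<notin> S"
  obtains k where "Suc k \<in> positions (restrict_word (Inf_Word \<alpha>) S)"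
    "letter (restrict_word (Inf_Word \<alpha>) S) k = \<alpha> q"
    "letter (restrict_word (Inf_Word \<alpha>) S) (Suc k) = \<alpha> q'"
proof -
  let ?J = "{j. \<alpha> j \<in> S}"
  obtain k where k: "enumerate ?J k = q" using enumerate_Ex[OF inf] q by blast
  have "enumerate ?J (Suc k) = (LEAST s. s \<in> ?J \<and> q < s)"
    using enumerate_Suc''[OF inf, of k] unfolding k .
  also have "\<dots> = q'"
    by (rule Least_equality) (use q linorder_not_le in blast)+
  finally have "enumerate ?J (Suc k) = q'" .
  then show thesis using that[of k] k inf by (simp add: Let_def)
qed

text \<open>Helly's theorem on a line, for finite sets in place of intervals: the point \<open>m\<close> belongs to the
  convex hull of every set.  It is the largest of the minima.  Each set has its own minimum below
  \<open>m\<close>, and shares an element with the set whose minimum is \<open>m\<close>.\<close>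

lemma Helly_linorder:
  fixes T :: "'i \<Rightarrow> 'l :: linorder set"
  assumes "finite I" "I \<noteq> {}" and fin: "\<And>q. q \<in> I \<Longrightarrow> finite (T q)"
    and meet: "\<And>q r. q \<in> I \<Longrightarrow> r \<in> I \<Longrightarrow> T q \<inter> T r \<noteq> {}"
  obtains q m where "q \<in> I" "m \<in> T q" "\<And>r. r \<in> I \<Longrightarrow> \<exists>c\<in>T r. c \<le> m" "\<And>r. r \<in> I \<Longrightarrow> \<exists>c\<in>T r. m \<le> c"
proof -
  have ne: "T r \<noteq> {}" if "r \<in> I" for r using meet[OF that that] by blast
  define m where "m = Max ((\<lambda>q. Min (T q)) ` I)"
  have "m \<in> (\<lambda>q. Min (T q)) ` I" unfolding m_def by (rule Max_in) (use assms in auto)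
  then obtain q where q: "q \<in> I" "m = Min (T q)" by blast
  have m: "m \<in> T q" unfolding q(2) using q(1) fin ne by (intro Min_in)
  have below: "\<exists>c\<in>T r. c \<le> m" if "r \<in> I" for r
  proof
    show "Min (T r) \<in> T r" using that fin ne by (intro Min_in)
    show "Min (T r) \<le> m" unfolding m_def using that assms(1) by (intro Max_ge) auto
  qed
  have above: "\<exists>c\<in>T r. m \<le> c" if r: "r \<in> I" for r
  proof -
    obtain c where "c \<in> T q" "c \<in> T r" using meet[OF q(1) r] by blast
    then show ?thesis using Min_le[OF fin[OF q(1)]] q(2) by blast
  qed
  show thesis using q(1) m below above by (rule that)
qed

text \<open>A path vertex has only two neighbours on the path, so a third one is a star.\<close>

lemma cubic_vertex_at_star:
  assumes G: "G \<in> path_star_class \<alpha>" and deg: "3 \<le> card (parcs G `` {v})"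
  shows "\<exists>p. Star_Vertex (\<alpha> p) \<in> pverts G \<and> v \<in> insert (Star_Vertex (\<alpha> p)) (parcs G `` {Star_Vertex (\<alpha> p)})"
proof (cases v)
  case (Star_Vertex a)
  have "parcs G `` {v} \<noteq> {}" using deg by auto
  then obtain w where w: "(v, w) \<in> parcs G" by blast
  then obtain p where "a = \<alpha> p"
    using path_star_class_arcs_iff[OF G] Star_Vertex by (cases w) auto
  moreover have "v \<in> pverts G" using w path_star_class_arcs_iff[OF G] by blast
  ultimately show ?thesis using Star_Vertex by blast
next
  case (Path_Vertex p)
  have "Star_Vertex (\<alpha> p) \<in> parcs G `` {v}"
  proof (rule ccontr)
    assume "Star_Vertex (\<alpha> p) \<notin> parcs G `` {v}"
    then have "parcs G `` {v} \<subseteq> {Path_Vertex (p - 1), Path_Vertex (Suc p)}"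
      using neighbours_of_path_vertex[OF G, of p] Path_Vertex by blast
    then have "card (parcs G `` {v}) \<le> card {Path_Vertex (p - 1), Path_Vertex (Suc p)}"
      by (intro card_mono) simp_all
    then show False using deg by simp
  qed
  then have "Star_Vertex (\<alpha> p) \<in> pverts G" "(Star_Vertex (\<alpha> p), v) \<in> parcs G"
    using path_star_class_arcs_iff[OF G] Path_Vertex by auto
  then show ?thesis by blast
qed

lemma disjoint_sets_avoid:
  assumes X: "finite X" "card X < k"
    and disj: "\<And>i j. i < k \<Longrightarrow> j < k \<Longrightarrow> i \<noteq> j \<Longrightarrow> R i \<inter> R j = {}"
  obtains i where "i < k" "R i \<inter> X = {}"
proof -
  have "\<exists>i<k. R i \<inter> X = {}"
  proof (rule ccontr)
    assume "\<not> ?thesis"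
    then have "\<forall>i<k. \<exists>x. x \<in> R i \<inter> X" by blast
    then obtain d where d: "\<And>i. i < k \<Longrightarrow> d i \<in> R i \<inter> X" by metis
    have "inj_on d {..<k}"
      by (rule inj_onI) (metis IntD1 IntI d disj empty_iff lessThan_iff)
    moreover have "d ` {..<k} \<subseteq> X" using d by auto
    ultimately have "card {..<k} \<le> card X" using card_inj_on_le X(1) by blast
    then show False using X(2) by simp
  qed
  then show thesis using that by blast
qed

text \<open>The situation in which nestedness is applied: \<open>S\<close> is the set of those letters whose star survives
  in \<open>G\<close>, so that the position of a path vertex \<open>p\<close> of \<open>G\<close> survives in \<open>\<alpha>\<^sup>S\<close> exactly if \<open>p\<close> has a star
  neighbour in \<open>G\<close>.\<close>

locale star_restriction =
  fixes \<alpha> :: "nat \<Rightarrow> nat" and G :: "path_star_vertex pair_pre_digraph"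
    and S B :: "nat set" and H :: "nat \<Rightarrow> nat set"
  assumes G: "G \<in> path_star_class \<alpha>"
    and S: "S = {a \<in> range \<alpha>. Star_Vertex a \<in> pverts G}"
    and inf: "infinite {j. \<alpha> j \<in> S}"
    and br: "branched (restrict_word (Inf_Word \<alpha>) S) S B H"
begin

text \<open>Pairs are ordered lexicographically, so comparing keys lists the branch letters branch by branch,
  and each branch in its own order.\<close>

definition key :: "nat \<Rightarrow> nat \<times> nat" where
  "key a = ((THE i. a \<in> H i), a)"

definition star_nbhd :: "nat \<Rightarrow> path_star_vertex set" where
  "star_nbhd a = insert (Star_Vertex a) (parcs G `` {Star_Vertex a})"

lemma partition: "base_branch_partition S B H"
  using br unfolding branched_def by blast

lemma finite_B: "finite B" and B_subset: "B \<subseteq> S"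
  using partition unfolding base_branch_partition_def by blast+

lemma key_branch: "a \<in> H i \<Longrightarrow> key a = (i, a)"
proof -
  assume a: "a \<in> H i"
  then have "j = i" if "a \<in> H j" for j
    using that partition unfolding base_branch_partition_def by blast
  with a have "(THE j. a \<in> H j) = i" by (rule the_equality)
  then show ?thesis by (simp add: key_def)
qed

lemma branch_ex: "a \<in> S - B \<Longrightarrow> \<exists>i. a \<in> H i"
  using partition unfolding base_branch_partition_def by blast

text \<open>Two consecutive letters of \<open>\<alpha>\<^sup>S\<close> outside the base are neighbours in a branch, hence
  neighbours in the order of keys, and no third letter \<open>b\<close> separates them.\<close>

lemma key_consecutive:
  assumes q: "q < q'" "\<alpha> q \<in> S" "\<alpha> q' \<in> S" "\<And>r. q < r \<Longrightarrow> r < q' \<Longrightarrow> \<alpha> r \<notin> S"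
    and notB: "\<alpha> q \<notin> B" "\<alpha> q' \<notin> B"
    and b: "b \<in> S - B" "b \<noteq> \<alpha> q" "b \<noteq> \<alpha> q'"
  shows "key (\<alpha> q) < key b \<longleftrightarrow> key (\<alpha> q') < key b"
proof -
  obtain k where k: "Suc k \<in> positions (restrict_word (Inf_Word \<alpha>) S)"
    "letter (restrict_word (Inf_Word \<alpha>) S) k = \<alpha> q"
    "letter (restrict_word (Inf_Word \<alpha>) S) (Suc k) = \<alpha> q'"
    using restrict_word_consecutive[OF inf q] .
  have "letter (restrict_word (Inf_Word \<alpha>) S) (Suc k) \<notin> B" using k notB by simp
  with br k(1) show ?thesis
  proof (cases rule: branched_predecessor)
    case base
    then show ?thesis using k notB by simp
  next
    case (branch i)
    then have i: "\<alpha> q \<in> H i" "\<alpha> q' \<in> H i" "\<alpha> q < \<alpha> q'"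
      and gap: "c \<in> H i \<Longrightarrow> \<not> (\<alpha> q < c \<and> c < \<alpha> q')" for c
      unfolding k by blast+
    obtain j where j: "b \<in> H j" using branch_ex b(1) by blast
    show ?thesis
    proof (cases "j = i")
      case True
      then have "\<not> (\<alpha> q < b \<and> b < \<alpha> q')" using gap j by blast
      then show ?thesis
        using i b True j by (auto simp: key_branch[OF i(1)] key_branch[OF i(2)] key_branch[OF j] less_prod_def)
    next
      case False
      then show ?thesis
        by (auto simp: key_branch[OF i(1)] key_branch[OF i(2)] key_branch[OF j] less_prod_def)
    qed
  qed
qed

text \<open>A stretch of \<open>\<alpha>\<close> that contains neither \<open>b\<close> nor a base letter stays on one side of \<open>b\<close>.\<close>

lemma key_interval:
  assumes "x \<le> y" "\<alpha> x \<in> S" "\<alpha> y \<in> S" "\<And>r. x \<le> r \<Longrightarrow> r \<le> y \<Longrightarrow> \<alpha> r \<notin> insert b B"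
    and b: "b \<in> S - B"
  shows "key (\<alpha> x) < key b \<longleftrightarrow> key (\<alpha> y) < key b"
  using assms(1-4)
proof (induction y rule: less_induct)
  case (less y)
  show ?case
  proof (cases "x = y")
    case True
    then show ?thesis by simp
  next
    case False
    let ?P = "{r. x \<le> r \<and> r < y \<and> \<alpha> r \<in> S}"
    define q where "q = Max ?P"
    have fin: "finite ?P" by simp
    have "x \<in> ?P" using less.prems False by simp
    then have "q \<in> ?P" unfolding q_def using Max_in[OF fin] by blast
    then have q: "x \<le> q" "q < y" "\<alpha> q \<in> S" by auto
    have gap: "\<alpha> r \<notin> S" if "q < r" "r < y" for r
    proof
      assume "\<alpha> r \<in> S"
      then have "r \<in> ?P" using that q by simp
      then have "r \<le> q" unfolding q_def using Max_ge[OF fin] by blast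
      then show False using that by simp
    qed
    have "key (\<alpha> x) < key b \<longleftrightarrow> key (\<alpha> q) < key b"
      by (rule less.IH[OF q(2,1)]) (use less.prems q in auto)
    also have "\<dots> \<longleftrightarrow> key (\<alpha> y) < key b"
      by (rule key_consecutive[OF q(2,3) less.prems(3) gap])
         (use less.prems(4)[of q] less.prems(4)[of y] less.prems(1) q b in auto)
    finally show ?thesis .
  qed
qed

lemma star_nbhd_path_vertex:
  assumes "Path_Vertex p \<in> pverts G" "a \<in> S"
  shows "Path_Vertex p \<in> star_nbhd a \<longleftrightarrow> \<alpha> p = a"
  using assms by (auto simp: star_nbhd_def S path_star_class_arcs_iff[OF G])

lemma star_nbhd_star_vertex: "Star_Vertex c \<in> star_nbhd a \<longleftrightarrow> c = a"
  by (auto simp: star_nbhd_def path_star_class_arcs_iff[OF G])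

text \<open>A connected set that avoids the closed neighbourhoods of all base stars cannot pass from one side
  of the letter \<open>b\<close> to the other without meeting the closed neighbourhood of \<open>b\<close>.  Along the path this is
  \<open>key_interval\<close>, and a star vertex connects only positions that carry the same letter.\<close>

lemma star_nbhd_separates:
  assumes Q: "connected_in (parcs G) Q" "Q \<subseteq> pverts G"
    and b: "b \<in> S - B" and avoid: "\<And>a. a \<in> insert b B \<Longrightarrow> Q \<inter> star_nbhd a = {}"
    and a: "a \<in> S - B" "Q \<inter> star_nbhd a \<noteq> {}"
    and c: "c \<in> S - B" "Q \<inter> star_nbhd c \<noteq> {}"
    and "key a < key b"
  shows "key c < key b"
proof -
  have letter: "\<alpha> p \<notin> insert b B" if "Path_Vertex p \<in> Q" for p
    using that avoid[of "\<alpha> p"] star_nbhd_path_vertex[of p "\<alpha> p"] Q(2) b B_subset by blast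
  \<comment> \<open>A path vertex without a star neighbour inherits its side of \<open>b\<close> from a letter of \<open>S\<close> that can be
      reached along the word without meeting \<open>b\<close> or a base letter.  The linking stretch need
      not lie in \<open>Q\<close>, so it can be prolonged freely when \<open>Q\<close> moves along the path.\<close>
  define linked where "linked p q \<longleftrightarrow> \<alpha> q \<in> S \<and> key (\<alpha> q) < key b \<and>
    (\<forall>r. min p q \<le> r \<and> r \<le> max p q \<longrightarrow> \<alpha> r \<notin> insert b B)" for p q
  define low where "low v \<longleftrightarrow> (case v of Star_Vertex e \<Rightarrow> key e < key b | Path_Vertex p \<Rightarrow> \<exists>q. linked p q)" for v
  have low_path: "low (Path_Vertex p) \<longleftrightarrow> key (\<alpha> p) < key b"
    if p: "Path_Vertex p \<in> Q" "\<alpha> p \<in> S" for p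
  proof
    assume "low (Path_Vertex p)"
    then obtain q where q: "\<alpha> q \<in> S" "key (\<alpha> q) < key b"
      "\<And>r. min p q \<le> r \<Longrightarrow> r \<le> max p q \<Longrightarrow> \<alpha> r \<notin> insert b B"
      by (auto simp: low_def linked_def)
    show "key (\<alpha> p) < key b"
    proof (cases "p \<le> q")
      case True
      then show ?thesis using key_interval[of p q b] p q b by (simp add: min_def max_def)
    next
      case False
      then show ?thesis using key_interval[of q p b] p q b by (simp add: min_def max_def)
    qed
  next
    assume "key (\<alpha> p) < key b"
    then have "linked p p" using p letter[of p] by (auto simp: linked_def)
    then show "low (Path_Vertex p)" by (auto simp: low_def)
  qed
  have low_step: "low (Path_Vertex p')"
    if p: "low (Path_Vertex p)" "p' = Suc p \<or> p = Suc p'" "Path_Vertex p' \<in> Q" for p p'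
  proof -
    obtain q where q: "linked p q" using p(1) by (auto simp: low_def)
    have "\<alpha> r \<notin> insert b B" if r: "min p' q \<le> r" "r \<le> max p' q" for r
    proof (cases "r = p'")
      case True
      then show ?thesis using letter p(3) by blast
    next
      case False
      then have "min p q \<le> r" "r \<le> max p q" using r p(2) by (auto simp: min_def max_def split: if_splits)
      then show ?thesis using q unfolding linked_def by blast
    qed
    then have "linked p' q" using q by (simp add: linked_def)
    then show ?thesis by (auto simp: low_def)
  qed
  have "{v \<in> Q. low v} = {} \<or> {v \<in> Q. low v} = Q"
  proof (rule connected_inD[OF Q(1)])
    fix u v assume u: "u \<in> {v \<in> Q. low v}" and v: "v \<in> Q" and uv: "(u, v) \<in> parcs G"
    have adj: "(u, v) \<in> parcs (path_star_graph \<alpha>)" "u \<in> pverts G" "v \<in> pverts G"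
      using uv path_star_class_arcs_iff[OF G] by blast+
    have "low v"
    proof (cases u; cases v)
      fix p p' assume "u = Path_Vertex p" "v = Path_Vertex p'"
      then show ?thesis using low_step[of p p'] u v adj by simp
    next
      fix p e assume e: "u = Path_Vertex p" "v = Star_Vertex e"
      then have "e = \<alpha> p" "\<alpha> p \<in> S" using adj by (auto simp: S)
      then show ?thesis using low_path[of p] u e by (simp add: low_def)
    next
      fix p e assume e: "u = Star_Vertex e" "v = Path_Vertex p"
      then have "e = \<alpha> p" "\<alpha> p \<in> S" using adj by (auto simp: S)
      then show ?thesis using low_path[of p] u v e by (simp add: low_def)
    next
      fix e e' assume "u = Star_Vertex e" "v = Star_Vertex e'"
      then show ?thesis using adj by simp
    qed
    then show "v \<in> {v \<in> Q. low v}" using v by blast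
  qed blast
  moreover have touch: "\<exists>v\<in>Q. low v \<longleftrightarrow> key e < key b"
    if e: "e \<in> S - B" "Q \<inter> star_nbhd e \<noteq> {}" for e
  proof -
    obtain v where v: "v \<in> Q" "v \<in> star_nbhd e" using e(2) by blast
    have "low v \<longleftrightarrow> key e < key b"
    proof (cases v)
      case (Path_Vertex p)
      then have "\<alpha> p = e" using star_nbhd_path_vertex[of p e] v e Q(2) by blast
      then show ?thesis using low_path[of p] v e Path_Vertex by blast
    next
      case (Star_Vertex d)
      then show ?thesis using v star_nbhd_star_vertex[of d e] by (simp add: low_def)
    qed
    then show ?thesis using v by blast
  qed
  ultimately show ?thesis using touch[OF a] touch[OF c] \<open>key a < key b\<close> by blast
qed

lemma card_star_nbhd:
  assumes "subcubic G" "a \<in> S"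
  shows "finite (star_nbhd a)" "card (star_nbhd a) \<le> 4"
proof -
  have "finite (parcs G `` {Star_Vertex a})" "card (parcs G `` {Star_Vertex a}) \<le> 3"
    using assms by (auto simp: subcubic_def S)
  then show "finite (star_nbhd a)" "card (star_nbhd a) \<le> 4"
    by (auto simp: star_nbhd_def card_insert_if)
qed

text \<open>The sets \<open>T q\<close> are the letter intervals of the crosses \<open>q\<close> (a row together with a column) that
  avoid \<open>Z\<close>.  Helly's theorem provides a letter \<open>b\<close> inside all of these intervals, while counting
  provides a cross that misses \<open>Z\<close> and the closed neighbourhood of \<open>b\<close>.\<close>

lemma mesh_bound:
  assumes sub: "subcubic G" and mesh: "mesh G k R C"
  shows "k \<le> 4 * card B + 4"
proof (rule ccontr)
  assume "\<not> ?thesis"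
  then have k: "4 * card B + 4 < k" by simp
  note nbhd = card_star_nbhd[OF sub]
  define Z where "Z = (\<Union>a\<in>B. star_nbhd a)"
  have Z: "finite Z" unfolding Z_def using finite_B nbhd(1) B_subset by blast
  have "card Z \<le> (\<Sum>a\<in>B. card (star_nbhd a))" unfolding Z_def by (rule card_UN_le[OF finite_B])
  also have "\<dots> \<le> (\<Sum>a\<in>B. 4)" by (rule sum_mono) (use nbhd(2) B_subset in blast)
  finally have card_Z: "card Z \<le> 4 * card B" by simp
  have avoiding: "\<exists>i j. i < k \<and> j < k \<and> (R i \<union> C j) \<inter> (Z \<union> Y) = {}"
    if Y: "finite Y" "card Y \<le> 4" for Y
  proof -
    have fin: "finite (Z \<union> Y)" using Z Y by simp
    have card: "card (Z \<union> Y) < k" using card_Un_le[of Z Y] card_Z Y k by linarith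
    obtain i where "i < k" "R i \<inter> (Z \<union> Y) = {}"
      using disjoint_sets_avoid[OF fin card mesh_disjoint(1)[OF mesh]] .
    moreover obtain j where "j < k" "C j \<inter> (Z \<union> Y) = {}"
      using disjoint_sets_avoid[OF fin card mesh_disjoint(2)[OF mesh]] .
    ultimately show ?thesis by blast
  qed
  define I where "I = {(i, j). i < k \<and> j < k \<and> (R i \<union> C j) \<inter> Z = {}}"
  define cross where "cross = (\<lambda>(i, j). R i \<union> C j)"
  define T where "T q = {a \<in> S - B. cross q \<inter> star_nbhd a \<noteq> {}}" for q
  have "I \<subseteq> {..<k} \<times> {..<k}" by (auto simp: I_def)
  then have fin_I: "finite I" using finite_subset by blast
  have I_ne: "I \<noteq> {}" using avoiding[of "{}"] by (auto simp: I_def)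
  have "finite (Star_Vertex ` S)"
    by (rule finite_subset[OF _ path_star_class_finite[OF G]]) (auto simp: S)
  then have "finite S" by (rule finite_imageD) (simp add: inj_on_def)
  then have fin_T: "finite (key ` T q)" for q by (simp add: T_def)
  have meet: "key ` T q \<inter> key ` T r \<noteq> {}" if qr: "q \<in> I" "r \<in> I" for q r
  proof -
    obtain i j i' j' where ij: "q = (i, j)" "r = (i', j')" by force
    then have less: "i < k" "j' < k" and Zq: "cross q \<inter> Z = {}"
      using qr by (auto simp: I_def cross_def)
    obtain v where v: "v \<in> R i" "v \<in> C j'" "3 \<le> card (parcs G `` {v})"
      using mesh_crossing[OF mesh less] by blast
    then have vqr: "v \<in> cross q" "v \<in> cross r" by (auto simp: cross_def ij)
    obtain a where a: "a \<in> S" "v \<in> star_nbhd a"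
      using cubic_vertex_at_star[OF G v(3)] unfolding star_nbhd_def S by blast
    have "a \<notin> B" using a(2) vqr(1) Zq unfolding Z_def by blast
    then have "a \<in> T q" "a \<in> T r" using a vqr by (auto simp: T_def)
    then show ?thesis by blast
  qed
  obtain q m where "q \<in> I" "m \<in> key ` T q"
    and below: "\<And>r. r \<in> I \<Longrightarrow> \<exists>c\<in>key ` T r. c \<le> m"
    and above: "\<And>r. r \<in> I \<Longrightarrow> \<exists>c\<in>key ` T r. m \<le> c"
    by (rule Helly_linorder[where T = "\<lambda>q. key ` T q", OF fin_I I_ne fin_T meet]) blast+
  then obtain b where b: "b \<in> S - B" "m = key b" by (auto simp: T_def)
  obtain i j where ij: "i < k" "j < k" "(R i \<union> C j) \<inter> (Z \<union> star_nbhd b) = {}"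
    using avoiding[of "star_nbhd b"] nbhd[of b] b by blast
  have r: "(i, j) \<in> I" using ij by (auto simp: I_def)
  let ?Q = "R i \<union> C j"
  have Q: "cross (i, j) = ?Q" by (simp add: cross_def)
  obtain a where a: "a \<in> T (i, j)" "key a \<le> key b" using below[OF r] b by blast
  obtain c where c: "c \<in> T (i, j)" "key b \<le> key c" using above[OF r] b by blast
  have "b \<notin> T (i, j)" using ij(3) unfolding T_def Q by blast
  then have "a \<noteq> b" using a(1) by blast
  then have "key a < key b" using a(2) by (auto simp: key_def less_prod_def less_eq_prod_def)
  moreover have "connected_in (parcs G) ?Q"
    using mesh_connected[OF mesh] mesh_crossing[OF mesh ij(1,2)] ij(1,2)
    by (intro connected_in_Un) blast+
  moreover have "?Q \<subseteq> pverts G" using mesh_verts[OF mesh] ij by blast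
  moreover have "?Q \<inter> star_nbhd d = {}" if "d \<in> insert b B" for d
    using that ij(3) unfolding Z_def by blast
  ultimately have "key c < key b"
    using star_nbhd_separates[of ?Q b a c] a(1) c(1) b(1) unfolding T_def Q by blast
  then show False using c(2) by simp
qed

end

lemma nested_mesh_bound:
  assumes nested: "b_nested b \<alpha> A B H" and G: "G \<in> path_star_class \<alpha>"
    and sub: "subcubic G" and mesh: "mesh G k R C"
  shows "k \<le> 4 * b + 4"
proof -
  define S where "S = {a \<in> range \<alpha>. Star_Vertex a \<in> pverts G}"
  have A: "range \<alpha> \<subseteq> A" "\<And>a. a \<in> A \<Longrightarrow> infinite {j. \<alpha> j = a}"
    using nested by (auto simp: b_nested_def branched_def)
  then have "S \<subseteq> A" by (auto simp: S_def)
  then obtain BS HS where card_BS: "card BS \<le> b" and br: "branched (restrict_word (Inf_Word \<alpha>) S) S BS HS"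
    using nested unfolding b_nested_def by blast
  show ?thesis
  proof (cases "S = {}")
    case True
    have "k = 0"
    proof (rule ccontr)
      assume "k \<noteq> 0"
      then obtain v where deg: "3 \<le> card (parcs G `` {v})"
        using mesh_crossing[OF mesh, of 0 0] by blast
      have "Star_Vertex (\<alpha> p) \<notin> pverts G" for p using True by (auto simp: S_def)
      then show False using cubic_vertex_at_star[OF G deg] by blast
    qed
    then show ?thesis by simp
  next
    case False
    then obtain a where a: "a \<in> S" by blast
    then have "infinite {j. \<alpha> j = a}" using A \<open>S \<subseteq> A\<close> by blast
    moreover have "{j. \<alpha> j = a} \<subseteq> {j. \<alpha> j \<in> S}" using a by blast
    ultimately have inf: "infinite {j. \<alpha> j \<in> S}" using finite_subset by blast
    interpret star_restriction \<alpha> G S BS HS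
      by unfold_locales (use G S_def inf br in auto)
    show ?thesis using mesh_bound[OF sub mesh] card_BS by linarith
  qed
qed

section \<open>Path-star classes of nested words are KKW-free\<close>

theorem theorem5p3:
  fixes \<alpha> :: "nat \<Rightarrow> nat"
  assumes "nested \<alpha>"
  shows "KKW_free (path_star_class \<alpha>)"
proof -
  obtain b A B H where nested: "b_nested b \<alpha> A B H" using assms by (auto simp: nested_def)
  then have br: "branched (Inf_Word \<alpha>) A B H" unfolding b_nested_def by blast
  \<comment> \<open>Large enough for \<open>nested_mesh_bound\<close>, for \<open>line_graph_mesh_bound\<close> and for the minimum degree 4
      that rules out complete and complete bipartite graphs.  A wall of side \<open>k + 1\<close> has a mesh of
      size \<open>k\<close>.\<close>
  define k where "k = 4 * b + 2 * card B + 5"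
  let ?t = "Suc k"
  have "\<not> (\<exists>G\<in>path_star_class \<alpha>. K\<^bsub>?t\<^esub> (with_proj G))"
    using no_large_complete_graph[of _ \<alpha> ?t] by (auto simp: k_def)
  moreover have "\<not> (\<exists>G\<in>path_star_class \<alpha>. K\<^bsub>?t,?t\<^esub> (with_proj G))"
    using no_large_complete_bipartite_graph[of _ \<alpha> ?t] by (auto simp: k_def)
  moreover have "\<not> class_contains (path_star_class \<alpha>) W"
    if W: "subdivision_pair (wall ?t ?t) W" for W
  proof
    assume "class_contains (path_star_class \<alpha>) W"
    then obtain f G where G: "G \<in> path_star_class \<alpha>" and emb:
      "inj_on f (pverts W)" "pverts G = f ` pverts W"
      "\<And>u v. u \<in> pverts W \<Longrightarrow> v \<in> pverts W \<Longrightarrow> (f u, f v) \<in> parcs G \<longleftrightarrow> (u, v) \<in> parcs W"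
      "parcs W \<subseteq> pverts W \<times> pverts W" "parcs G \<subseteq> pverts G \<times> pverts G"
      by (rule class_contains_embedding) blast
    obtain R C where "subcubic W" "mesh W k R C" using mesh_in_subdivided_wall[OF W] by blast
    then have "subcubic G" "mesh G k (\<lambda>i. f ` R i) (\<lambda>j. f ` C j)"
      using mesh_image[OF emb] by blast+
    then show False using nested_mesh_bound[OF nested G] by (force simp: k_def)
  qed
  moreover have "\<not> class_contains (path_star_class \<alpha>) (line_graph W)"
    if W: "subdivision_pair (wall ?t ?t) W" for W
  proof
    assume cc: "class_contains (path_star_class \<alpha>) (line_graph W)"
    obtain R C where "pair_bidirected_digraph W" "mesh W k R C"
      using mesh_in_subdivided_wall[OF W] by blast
    from line_graph_mesh_bound[OF br this cc] show False by (simp add: k_def)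
  qed
  ultimately show ?thesis
    unfolding KKW_free_def using hereditary_path_star_class[of \<alpha>]
    by (intro conjI exI[of _ ?t]) auto
qed

end
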